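(* Let $\theta\in\Lambda_1(n)$ and $\beta\in(\Lambda_1(n))'$. The Toeplitz operator $T_{\theta,\beta}:\Lambda_1(n)\to\Lambda_1(n)$ is (i) strongly tame, and hence m-topologizable, if $\sum_{n\in\mathbb{N}}|\beta_{n-1}|e^n<\infty$; (ii) power bounded if $\sup_{p\in\mathbb{N}}e^{\frac{1}{2p}}\|\theta\|_{2p}+\sum_{n\in\mathbb{N}}|\beta_{n-1}|e^n\le1$.
   Context: $\mathbb{N}=\{1,2,\dots\}$, $\mathbb{N}_0=\mathbb{N}\cup\{0\}$. $\Lambda_1(n)=\{x=(x_n)_{n\in\mathbb{N}}:\|x\|_k:=\sum_{n=1}^\infty|x_n|e^{-\frac1kn}<\infty\text{ for all }k\in\mathbb{N}\}$, a Fréchet space with seminorms $(\|\cdot\|_k)_{k\in\mathbb{N}}$ and canonical basis $(e_n)_{n\in\mathbb{N}}$. Symbols are indexed from $0$, with $\theta_{n-1}$ (resp. $\beta_{n-1}$) the $n$-th coordinate: $\theta=(\theta_n)_{n\in\mathbb{N}_0}\in\Lambda_1(n)$ with $\|\theta\|_k=\sum_{n=1}^\infty|\theta_{n-1}|e^{-\frac1kn}$, and $\beta=(\beta_n)_{n\in\mathbb{N}_0}\in(\Lambda_1(n))'$ means that $|\beta_{n-1}|\le Ce^{-\frac1mn}$ for all $n\in\mathbb{N}$, for some $m\in\mathbb{N}$, $C>0$. Define the linear operators $\widehat{T}_\theta e_n=\sum_{j=n}^\infty\theta_{j-n}e_j$ and $\check{T}_\beta e_n=\sum_{j=1}^n\beta_{n-j}e_j$,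 extended by $Tx=\sum_{n=1}^\infty x_nTe_n$ (both are well-defined and continuous on $\Lambda_1(n)$), and the Toeplitz operator $T_{\theta,\beta}=\widehat{T}_\theta+\check{T}_\beta$. A linear operator $T$ on a Fréchet space $E$ with increasing seminorms $(\|\cdot\|_p)_{p\in\mathbb{N}}$ is strongly tame if for every $p\in\mathbb{N}$ there is $C_p>0$ with $\|Tx\|_p\le C_p\|x\|_p$ for all $x\in E$; a continuous linear $T$ is m-topologizable if for every $p\in\mathbb{N}$ there exist $q\in\mathbb{N}$ and $C_p\ge1$ with $\|T^kx\|_p\le C_p^k\|x\|_q$ for all $k\in\mathbb{N}$, $x\in E$; it is power bounded if for every $p\in\mathbb{N}$ there exist $q\in\mathbb{N}$ and $C_p\ge1$ with $\|T^kx\|_p\le C_p\|x\|_q$ for all $k\in\mathbb{N}$, $x\in E$. *)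

theory Defs
  imports "HOL-Analysis.Analysis" "HOL-Library.Function_Algebras"
begin

text \<open>
  The data of a Frechet space (completeness is not imposed) are a carrier \<open>E\<close> inside an abelian group, a scalar
  multiplication \<open>s\<close>, and an increasing sequence \<open>P\<close> of seminorms on \<open>E\<close>. The seminorms are indexed
  by the positive integers, so \<open>P 0\<close> is never used.
\<close>

definition seminorm_topology :: "'v::ab_group_add set \<Rightarrow> (nat \<Rightarrow> 'v \<Rightarrow> real) \<Rightarrow> 'v topology" where
  "seminorm_topology E P =
     topology_generated_by {{y \<in> E. P p (y - x) < \<epsilon>} | x p \<epsilon>. x \<in> E \<and> 1 \<le> p \<and> 0 < \<epsilon>}"

definition linear_operator ::
    "('k \<Rightarrow> 'v \<Rightarrow> 'v) \<Rightarrow> 'v::ab_group_add set \<Rightarrow> ('v \<Rightarrow> 'v) \<Rightarrow> bool" where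
  "linear_operator s E T \<longleftrightarrow>
     T ` E \<subseteq> E \<and>
     (\<forall>x\<in>E. \<forall>y\<in>E. T (x + y) = T x + T y) \<and>
     (\<forall>c. \<forall>x\<in>E. T (s c x) = s c (T x))"

definition continuous_linear_operator ::
    "('k \<Rightarrow> 'v \<Rightarrow> 'v) \<Rightarrow> 'v::ab_group_add set \<Rightarrow> (nat \<Rightarrow> 'v \<Rightarrow> real) \<Rightarrow> ('v \<Rightarrow> 'v) \<Rightarrow> bool" where
  "continuous_linear_operator s E P T \<longleftrightarrow>
     linear_operator s E T \<and>
     continuous_map (seminorm_topology E P) (seminorm_topology E P) T"

definition strongly_tame ::
    "('k \<Rightarrow> 'v \<Rightarrow> 'v) \<Rightarrow> 'v::ab_group_add set \<Rightarrow> (nat \<Rightarrow> 'v \<Rightarrow> real) \<Rightarrow> ('v \<Rightarrow> 'v) \<Rightarrow> bool" where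
  "strongly_tame s E P T \<longleftrightarrow>
     linear_operator s E T \<and>
     (\<forall>p\<ge>1. \<exists>C>0. \<forall>x\<in>E. P p (T x) \<le> C * P p x)"

definition m_topologizable ::
    "('k \<Rightarrow> 'v \<Rightarrow> 'v) \<Rightarrow> 'v::ab_group_add set \<Rightarrow> (nat \<Rightarrow> 'v \<Rightarrow> real) \<Rightarrow> ('v \<Rightarrow> 'v) \<Rightarrow> bool" where
  "m_topologizable s E P T \<longleftrightarrow>
     continuous_linear_operator s E P T \<and>
     (\<forall>p\<ge>1. \<exists>q\<ge>1. \<exists>C\<ge>1. \<forall>k\<ge>1. \<forall>x\<in>E. P p ((T ^^ k) x) \<le> C ^ k * P q x)"

definition power_bounded ::
    "('k \<Rightarrow> 'v \<Rightarrow> 'v) \<Rightarrow> 'v::ab_group_add set \<Rightarrow> (nat \<Rightarrow> 'v \<Rightarrow> real) \<Rightarrow> ('v \<Rightarrow> 'v) \<Rightarrow> bool" where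
  "power_bounded s E P T \<longleftrightarrow>
     continuous_linear_operator s E P T \<and>
     (\<forall>p\<ge>1. \<exists>q\<ge>1. \<exists>C\<ge>1. \<forall>k\<ge>1. \<forall>x\<in>E. P p ((T ^^ k) x) \<le> C * P q x)"

text \<open>
  Sequences are functions on \<open>nat\<close>, and the value at \<open>i\<close> is the \<open>(i+1)\<close>-th coordinate;
  hence the weight \<open>exp (- (i + 1) / k)\<close>. A symbol then has \<open>\<theta> i\<close> equal to \<open>\<theta>\<^sub>i\<close>, and the
  basis vector with its \<open>1\<close> at position \<open>i\<close> is \<open>e\<^sub>n\<close> for \<open>n = i + 1\<close>.
  The scalar class is satisfied by the real and by the complex numbers.
\<close>

definition seq_scale :: "'a::{real_normed_field,banach} \<Rightarrow> (nat \<Rightarrow> 'a) \<Rightarrow> (nat \<Rightarrow> 'a)" where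
  "seq_scale c x = (\<lambda>i. c * x i)"

definition Lambda1_norm :: "nat \<Rightarrow> (nat \<Rightarrow> 'a::{real_normed_field,banach}) \<Rightarrow> real" where
  "Lambda1_norm k x = (\<Sum>i. norm (x i) * exp (- (real (i + 1) / real k)))"

definition Lambda1 :: "(nat \<Rightarrow> 'a::{real_normed_field,banach}) set" where
  "Lambda1 = {x. \<forall>k\<ge>1. summable (\<lambda>i. norm (x i) * exp (- (real (i + 1) / real k)))}"

definition Lambda1_dual :: "(nat \<Rightarrow> 'a::{real_normed_field,banach}) set" where
  "Lambda1_dual =
     {b. \<exists>m\<ge>1. \<exists>C>0. \<forall>i. norm (b i) \<le> C * exp (- (real (i + 1) / real (m::nat)))}"

text \<open>
  The operator determined by the images \<open>B n\<close> of the basis vectors: \<open>basis_extension B x\<close> is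
  the sum of the series of the \<open>x n \<cdot> B n\<close>, convergent in the topology of \<open>Lambda1\<close>.
\<close>

definition basis_extension ::
    "(nat \<Rightarrow> nat \<Rightarrow> 'a::{real_normed_field,banach}) \<Rightarrow> (nat \<Rightarrow> 'a) \<Rightarrow> (nat \<Rightarrow> 'a)" where
  "basis_extension B x =
     (THE y. limitin (seminorm_topology Lambda1 Lambda1_norm)
               (\<lambda>N. \<Sum>n<N. seq_scale (x n) (B n)) y sequentially)"

definition toeplitz_hat :: "(nat \<Rightarrow> 'a::{real_normed_field,banach}) \<Rightarrow> (nat \<Rightarrow> 'a) \<Rightarrow> (nat \<Rightarrow> 'a)" where
  "toeplitz_hat \<theta> = basis_extension (\<lambda>n j. if n \<le> j then \<theta> (j - n) else 0)"

definition toeplitz_check :: "(nat \<Rightarrow> 'a::{real_normed_field,banach}) \<Rightarrow> (nat \<Rightarrow> 'a) \<Rightarrow> (nat \<Rightarrow> 'a)" where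
  "toeplitz_check \<beta> = basis_extension (\<lambda>n j. if j \<le> n then \<beta> (n - j) else 0)"

definition toeplitz ::
    "(nat \<Rightarrow> 'a::{real_normed_field,banach}) \<Rightarrow> (nat \<Rightarrow> 'a) \<Rightarrow> (nat \<Rightarrow> 'a) \<Rightarrow> (nat \<Rightarrow> 'a)" where
  "toeplitz \<theta> \<beta> = (\<lambda>x. toeplitz_hat \<theta> x + toeplitz_check \<beta> x)"

end

theory Submission
  imports Defs
begin

text \<open>
  Write \<open>T\<^sub>n\<close> for the image of the basis vector \<open>e\<^sub>n\<close> under one of the two triangular operators. Since
  \<open>\<parallel>e\<^sub>n\<parallel>\<^sub>k = e\<^bsup>-n/k\<^esup>\<close>, every \<open>\<parallel>\<cdot>\<parallel>\<^sub>k\<close> is a weighted \<open>\<ell>\<^sup>1\<close> norm, and the countable triangle inequality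
  \<open>\<parallel>\<Sum> x\<^sub>n T\<^sub>n\<parallel>\<^sub>k \<le> \<Sum> \<bar>x\<^sub>n\<bar> \<parallel>T\<^sub>n\<parallel>\<^sub>k\<close> reduces a bound \<open>\<parallel>T x\<parallel>\<^sub>k \<le> K \<parallel>x\<parallel>\<^sub>k\<close> with the same seminorm on
  both sides to the bound \<open>\<parallel>T\<^sub>n\<parallel>\<^sub>k \<le> K e\<^bsup>-n/k\<^esup>\<close> on the columns (\<open>tame_columns\<close>). The same estimate,
  applied to tails, shows that the series of the \<open>x\<^sub>n T\<^sub>n\<close> converges to its coordinatewise sum, so
  that the operators are given by explicit coordinate formulas (\<open>basis_extension_eq\<close>).

  The column of \<open>\<theta>\<close> is \<open>\<theta>\<close> shifted by \<open>n - 1\<close> places, and the weight is multiplicative, so its norm is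
  exactly \<open>e\<^bsup>1/k\<^esup> \<parallel>\<theta>\<parallel>\<^sub>k e\<^bsup>-n/k\<^esup>\<close> (\<open>tame_columns_hat\<close>). The column of \<open>\<beta>\<close> is a reflection, which moves
  mass to indices where the weight is larger, by a factor at most \<open>e\<^bsup>i/k\<^esup> \<le> e\<^sup>i\<close> for a move by \<open>i\<close>
  places; the assumption on \<open>\<beta>\<close> absorbs this factor uniformly in \<open>k\<close> (\<open>tame_columns_check\<close>). Together,
  \<open>\<parallel>T\<^bsub>\<theta>,\<beta>\<^esub> x\<parallel>\<^sub>k \<le> (e\<^bsup>1/k\<^esup> \<parallel>\<theta>\<parallel>\<^sub>k + \<Sum> \<bar>\<beta>\<^bsub>n-1\<^esub>\<bar> e\<^sup>n) \<parallel>x\<parallel>\<^sub>k\<close>, which is strong tameness. Iterating it gives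
  m-topologizability with \<open>q = p\<close>. Under the second assumption the constant is at most \<open>1\<close> for
  \<open>k = 2p\<close>, so \<open>T\<^bsub>\<theta>,\<beta>\<^esub>\<close> is a contraction for \<open>\<parallel>\<cdot>\<parallel>\<^bsub>2p\<^esub>\<close>, and all powers are bounded from \<open>\<parallel>\<cdot>\<parallel>\<^bsub>2p\<^esub>\<close>
  to \<open>\<parallel>\<cdot>\<parallel>\<^sub>p \<le> \<parallel>\<cdot>\<parallel>\<^bsub>2p\<^esub>\<close>.
\<close>

section \<open>Operators on spaces with a family of seminorms\<close>

text \<open>
  Only the metric properties of the seminorms enter the topological arguments, so the family is
  treated as one of translation-invariant pseudometrics \<open>P p (x - y)\<close> on a subgroup \<open>E\<close>.
\<close>

locale seminorm_family =
  fixes E :: "'v::ab_group_add set" and P :: "nat \<Rightarrow> 'v \<Rightarrow> real"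
  assumes diff_closed: "x \<in> E \<Longrightarrow> y \<in> E \<Longrightarrow> x - y \<in> E"
    and seminorm_zero: "1 \<le> p \<Longrightarrow> P p 0 = 0"
    and seminorm_minus_commute: "1 \<le> p \<Longrightarrow> x \<in> E \<Longrightarrow> y \<in> E \<Longrightarrow> P p (x - y) = P p (y - x)"
    and seminorm_triangle: "1 \<le> p \<Longrightarrow> x \<in> E \<Longrightarrow> y \<in> E \<Longrightarrow> P p (x + y) \<le> P p x + P p y"
begin

abbreviation seminorm_ball :: "nat \<Rightarrow> 'v \<Rightarrow> real \<Rightarrow> 'v set" where
  "seminorm_ball p x \<epsilon> \<equiv> {y \<in> E. P p (y - x) < \<epsilon>}"

lemma seminorm_triangle_diff:
  assumes "1 \<le> p" "x \<in> E" "y \<in> E" "z \<in> E"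
  shows "P p (x - z) \<le> P p (x - y) + P p (y - z)"
  using seminorm_triangle[OF assms(1) diff_closed[OF assms(2,3)] diff_closed[OF assms(3,4)]] by simp

lemma openin_seminorm_ball:
  assumes "1 \<le> p" "x \<in> E" "0 < \<epsilon>"
  shows "openin (seminorm_topology E P) (seminorm_ball p x \<epsilon>)"
  unfolding seminorm_topology_def by (rule topology_generated_by_Basis) (use assms in blast)

lemma topspace_seminorm_topology: "topspace (seminorm_topology E P) = E"
proof
  show "topspace (seminorm_topology E P) \<subseteq> E"
    unfolding seminorm_topology_def topology_generated_by_topspace by auto
  show "E \<subseteq> topspace (seminorm_topology E P)"
  proof
    fix x assume x: "x \<in> E"
    then have "x \<in> seminorm_ball 1 x 1" by (simp add: seminorm_zero)
    with openin_subset[OF openin_seminorm_ball[of 1 x 1]] x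
    show "x \<in> topspace (seminorm_topology E P)" by auto
  qed
qed

text \<open>
  The balls are only a subbasis of the topology, but this is enough: an intersection of finitely many
  sets is eventually visited if each of them is, and a ball around \<open>x\<close> that contains \<open>y\<close> contains
  a smaller ball around \<open>y\<close> for the same seminorm.
\<close>

lemma limitin_seminorm_topology:
  "limitin (seminorm_topology E P) f y F \<longleftrightarrow>
    y \<in> E \<and> (\<forall>p\<ge>1. \<forall>\<epsilon>>0. \<forall>\<^sub>F n in F. f n \<in> seminorm_ball p y \<epsilon>)"
proof (intro iffI conjI allI impI)
  assume lim: "limitin (seminorm_topology E P) f y F"
  then show y: "y \<in> E"
    using limitin_topspace[OF lim] by (simp only: topspace_seminorm_topology)
  fix p :: nat and \<epsilon> :: real assume "1 \<le> p" "0 < \<epsilon>"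
  then show "\<forall>\<^sub>F n in F. f n \<in> seminorm_ball p y \<epsilon>"
    using lim openin_seminorm_ball[of p y \<epsilon>] y seminorm_zero[of p] unfolding limitin_def by auto
next
  assume A: "y \<in> E \<and> (\<forall>p\<ge>1. \<forall>\<epsilon>>0. \<forall>\<^sub>F n in F. f n \<in> seminorm_ball p y \<epsilon>)"
  define S where "S = {seminorm_ball p x \<epsilon> | x p \<epsilon>. x \<in> E \<and> 1 \<le> p \<and> 0 < \<epsilon>}"
  have gen: "y \<in> U \<longrightarrow> (\<forall>\<^sub>F n in F. f n \<in> U)" if "generate_topology_on S U" for U
    using that
  proof (induction rule: generate_topology_on.induct)
    case (Int a b)
    then show ?case by (simp add: eventually_conj_iff)
  next
    case (UN K)
    show ?case
    proof
      assume "y \<in> \<Union>K"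
      then obtain k where "k \<in> K" "y \<in> k" by blast
      then have "\<forall>\<^sub>F n in F. f n \<in> k" using UN.IH[of k] by blast
      then show "\<forall>\<^sub>F n in F. f n \<in> \<Union>K"
        by (rule eventually_mono) (use \<open>k \<in> K\<close> in blast)
    qed
  next
    case (Basis s)
    then obtain x p \<epsilon> where s: "s = seminorm_ball p x \<epsilon>" "x \<in> E" "1 \<le> p"
      unfolding S_def by blast
    show ?case
    proof
      assume "y \<in> s"
      then have "0 < \<epsilon> - P p (y - x)" using s by simp
      then have "\<forall>\<^sub>F n in F. f n \<in> seminorm_ball p y (\<epsilon> - P p (y - x))"
        using A s(3) by blast
      then show "\<forall>\<^sub>F n in F. f n \<in> s"
      proof (rule eventually_mono)
        fix n assume "f n \<in> seminorm_ball p y (\<epsilon> - P p (y - x))"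
        then show "f n \<in> s"
          using seminorm_triangle_diff[of p "f n" y x] s A by auto
      qed
    qed
  qed simp
  show "limitin (seminorm_topology E P) f y F"
    unfolding limitin_def topspace_seminorm_topology
  proof (intro conjI allI impI)
    show "y \<in> E" using A by blast
    fix U assume U: "openin (seminorm_topology E P) U \<and> y \<in> U"
    then have "generate_topology_on S U"
      by (simp add: seminorm_topology_def S_def openin_topology_generated_by_iff)
    then show "\<forall>\<^sub>F n in F. f n \<in> U" using gen U by blast
  qed
qed

lemma limitin_seminorm_unique:
  assumes "limitin (seminorm_topology E P) f y F" "limitin (seminorm_topology E P) f z F"
    and "F \<noteq> bot" and p: "1 \<le> p"
  shows "P p (y - z) \<le> 0"
proof (rule ccontr)
  define \<delta> where "\<delta> = P p (y - z) / 2"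
  assume "\<not> P p (y - z) \<le> 0"
  then have "0 < \<delta>" by (simp add: \<delta>_def)
  then have "\<forall>\<^sub>F n in F. f n \<in> seminorm_ball p y \<delta>" "\<forall>\<^sub>F n in F. f n \<in> seminorm_ball p z \<delta>"
    using assms(1,2) p unfolding limitin_seminorm_topology by blast+
  then have "\<forall>\<^sub>F n in F. f n \<in> seminorm_ball p y \<delta> \<and> f n \<in> seminorm_ball p z \<delta>"
    by (rule eventually_conj)
  then obtain n where n: "f n \<in> seminorm_ball p y \<delta>" "f n \<in> seminorm_ball p z \<delta>"
    using \<open>F \<noteq> bot\<close> eventually_happens' by blast
  have mem: "y \<in> E" "z \<in> E" "f n \<in> E"
    using assms n unfolding limitin_seminorm_topology by auto
  have "P p (y - z) \<le> P p (f n - y) + P p (f n - z)"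
    using seminorm_triangle_diff[OF p mem(1,3,2)] seminorm_minus_commute[OF p mem(1,3)] by simp
  also have "\<dots> < \<delta> + \<delta>" using n by (intro add_strict_mono) auto
  finally show False by (simp add: \<delta>_def)
qed

text \<open>
  The preimage of a ball of \<open>P p\<close> is a union of balls of the same \<open>P p\<close>, with radii divided by the
  tameness constant.
\<close>

lemma continuous_if_strongly_tame:
  assumes "strongly_tame s E P T"
  shows "continuous_linear_operator s E P T"
  unfolding continuous_linear_operator_def
proof
  show lin: "linear_operator s E T" using assms unfolding strongly_tame_def by blast
  have T: "T x \<in> E" if "x \<in> E" for x
    using lin that unfolding linear_operator_def by blast
  have T_diff: "T (y - x) = T y - T x" if "x \<in> E" "y \<in> E" for x y
  proof -
    have "T (y - x + x) = T (y - x) + T x"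
      using lin that diff_closed unfolding linear_operator_def by blast
    then show ?thesis by simp
  qed
  show "continuous_map (seminorm_topology E P) (seminorm_topology E P) T"
    unfolding seminorm_topology_def[of E P]
  proof (rule continuous_on_generated_topo, fold seminorm_topology_def)
    fix U assume "U \<in> {{y \<in> E. P p (y - x) < \<epsilon>} | x p \<epsilon>. x \<in> E \<and> 1 \<le> p \<and> 0 < \<epsilon>}"
    then obtain z p \<epsilon> where U: "U = seminorm_ball p z \<epsilon>" "z \<in> E" "1 \<le> p" by blast
    obtain C where C: "C > 0" "\<And>x. x \<in> E \<Longrightarrow> P p (T x) \<le> C * P p x"
      using assms U(3) unfolding strongly_tame_def by blast
    show "openin (seminorm_topology E P) (T -` U \<inter> topspace (seminorm_topology E P))"
      unfolding topspace_seminorm_topology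
    proof (subst openin_subopen, intro ballI)
      fix x assume x: "x \<in> T -` U \<inter> E"
      define \<delta> where "\<delta> = (\<epsilon> - P p (T x - z)) / C"
      have \<delta>: "\<delta> > 0" using x C(1) by (auto simp: \<delta>_def U)
      \<comment> \<open>\<open>\<delta>\<close> makes \<open>C * \<delta>\<close> the distance left between \<open>T x\<close> and the boundary of the ball \<open>U\<close>.\<close>
      have "seminorm_ball p x \<delta> \<subseteq> T -` U \<inter> E"
      proof
        fix y assume y: "y \<in> seminorm_ball p x \<delta>"
        have "P p (T y - T x) \<le> C * P p (y - x)"
          using C(2)[of "y - x"] T_diff[of x y] x y diff_closed by auto
        also have "\<dots> < C * \<delta>" using y C(1) by auto
        also have "C * \<delta> = \<epsilon> - P p (T x - z)" using C(1) by (simp add: \<delta>_def)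
        finally have "P p (T y - z) < \<epsilon>"
          using seminorm_triangle_diff[OF U(3), of "T y" "T x" z] T U(2) x y by auto
        then show "y \<in> T -` U \<inter> E" using y T by (auto simp: U)
      qed
      moreover have "x \<in> seminorm_ball p x \<delta>" using x \<delta> U(3) by (auto simp: seminorm_zero)
      ultimately show "\<exists>V. openin (seminorm_topology E P) V \<and> x \<in> V \<and> V \<subseteq> T -` U \<inter> E"
        using openin_seminorm_ball[OF U(3) _ \<delta>, of x] x by blast
    qed
  next
    show "T ` topspace (seminorm_topology E P)
      \<subseteq> \<Union> {{y \<in> E. P p (y - x) < \<epsilon>} | x p \<epsilon>. x \<in> E \<and> 1 \<le> p \<and> 0 < \<epsilon>}"
      using T topspace_seminorm_topology
      unfolding seminorm_topology_def topology_generated_by_topspace by auto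
  qed
qed

end

lemma funpow_seminorm_bound:
  fixes Q :: "'v \<Rightarrow> real"
  assumes "T ` E \<subseteq> E" and "\<And>x. x \<in> E \<Longrightarrow> Q (T x) \<le> C * Q x" and "0 \<le> C" and "x \<in> E"
  shows "(T ^^ k) x \<in> E \<and> Q ((T ^^ k) x) \<le> C ^ k * Q x"
proof (induction k)
  case 0
  then show ?case using assms by simp
next
  case (Suc k)
  have "Q ((T ^^ Suc k) x) \<le> C * Q ((T ^^ k) x)" using Suc assms(2) by simp
  also have "\<dots> \<le> C * (C ^ k * Q x)" using Suc assms(3) by (simp add: mult_left_mono)
  finally show ?case using Suc assms(1) by (auto simp: mult.assoc)
qed

lemma (in seminorm_family) m_topologizable_if_strongly_tame:
  assumes tame: "strongly_tame s E P T" and nonneg: "\<And>p x. 1 \<le> p \<Longrightarrow> x \<in> E \<Longrightarrow> 0 \<le> P p x"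
  shows "m_topologizable s E P T"
  unfolding m_topologizable_def
proof (intro conjI allI impI)
  show "continuous_linear_operator s E P T" by (rule continuous_if_strongly_tame[OF tame])
  fix p :: nat assume p: "1 \<le> p"
  obtain C where C: "\<And>x. x \<in> E \<Longrightarrow> P p (T x) \<le> C * P p x"
    using tame p unfolding strongly_tame_def by blast
  have "P p ((T ^^ k) x) \<le> (max 1 C) ^ k * P p x" if "x \<in> E" for k x
  proof -
    have T: "T ` E \<subseteq> E" using tame unfolding strongly_tame_def linear_operator_def by blast
    have "P p (T x) \<le> max 1 C * P p x" if "x \<in> E" for x
      using C[OF that] mult_right_mono[OF max.cobounded2[of C 1] nonneg[OF p that]] by simp
    then show ?thesis using funpow_seminorm_bound[where Q="P p" and C="max 1 C", OF T] that by auto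
  qed
  then show "\<exists>q\<ge>1. \<exists>C\<ge>1. \<forall>k\<ge>1. \<forall>x\<in>E. P p ((T ^^ k) x) \<le> C ^ k * P q x"
    using p by (intro exI[of _ p] conjI exI[of _ "max 1 C"]) auto
qed

section \<open>The seminorms of the power series space\<close>

definition Lambda1_weight :: "nat \<Rightarrow> nat \<Rightarrow> real" where
  "Lambda1_weight k i = exp (- (real (i + 1) / real k))"

lemma Lambda1_weight_pos: "0 < Lambda1_weight k i"
  by (simp add: Lambda1_weight_def)

lemma Lambda1_weight_nonneg: "0 \<le> Lambda1_weight k i"
  using Lambda1_weight_pos[of k i] by linarith

lemma Lambda1_norm_weight: "Lambda1_norm k x = (\<Sum>i. norm (x i) * Lambda1_weight k i)"
  by (simp add: Lambda1_norm_def Lambda1_weight_def)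

lemma Lambda1_iff: "x \<in> Lambda1 \<longleftrightarrow> (\<forall>k\<ge>1. summable (\<lambda>i. norm (x i) * Lambda1_weight k i))"
  by (simp add: Lambda1_def Lambda1_weight_def)

lemma Lambda1_summable: "x \<in> Lambda1 \<Longrightarrow> 1 \<le> k \<Longrightarrow> summable (\<lambda>i. norm (x i) * Lambda1_weight k i)"
  by (simp add: Lambda1_iff)

lemma Lambda1_norm_nonneg: "x \<in> Lambda1 \<Longrightarrow> 1 \<le> k \<Longrightarrow> 0 \<le> Lambda1_norm k x"
  unfolding Lambda1_norm_weight by (intro suminf_nonneg Lambda1_summable) (auto simp: Lambda1_weight_nonneg)

lemma Lambda1_norm_coord_le:
  assumes "x \<in> Lambda1" "1 \<le> k"
  shows "norm (x i) * Lambda1_weight k i \<le> Lambda1_norm k x"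
  using sum_le_suminf[OF Lambda1_summable[OF assms], of "{i}"]
  by (simp add: Lambda1_norm_weight Lambda1_weight_nonneg)

lemma Lambda1_add_aux:
  assumes "x \<in> Lambda1" "y \<in> Lambda1" "1 \<le> k"
  shows "summable (\<lambda>i. norm (x i + y i) * Lambda1_weight k i)"
    and "Lambda1_norm k (x + y) \<le> Lambda1_norm k x + Lambda1_norm k y"
proof -
  let ?w = "Lambda1_weight k"
  note sx = Lambda1_summable[OF assms(1,3)] and sy = Lambda1_summable[OF assms(2,3)]
  have le: "norm (x i + y i) * ?w i \<le> norm (x i) * ?w i + norm (y i) * ?w i" for i
    using mult_right_mono[OF norm_triangle_ineq[of "x i" "y i"] Lambda1_weight_nonneg[of k i]]
    by (simp add: distrib_right)
  show s: "summable (\<lambda>i. norm (x i + y i) * ?w i)"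
    by (rule summable_comparison_test'[OF summable_add[OF sx sy], of 0])
       (use le in \<open>simp add: Lambda1_weight_nonneg abs_mult\<close>)
  show "Lambda1_norm k (x + y) \<le> Lambda1_norm k x + Lambda1_norm k y"
    unfolding Lambda1_norm_weight plus_fun_apply suminf_add[OF sx sy]
    by (intro suminf_le le s summable_add sx sy)
qed

lemma Lambda1_add: "x \<in> Lambda1 \<Longrightarrow> y \<in> Lambda1 \<Longrightarrow> x + y \<in> Lambda1"
  by (simp add: Lambda1_iff Lambda1_add_aux(1) Lambda1_iff[of "x + y"])

lemma Lambda1_uminus: "x \<in> Lambda1 \<Longrightarrow> - x \<in> Lambda1"
  by (simp add: Lambda1_iff)

lemma Lambda1_diff: "x \<in> Lambda1 \<Longrightarrow> y \<in> Lambda1 \<Longrightarrow> x - y \<in> Lambda1"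
  using Lambda1_add[OF _ Lambda1_uminus, of x y] by simp

lemma Lambda1_scale: "x \<in> Lambda1 \<Longrightarrow> seq_scale c x \<in> Lambda1"
  by (auto simp: Lambda1_iff seq_scale_def norm_mult mult.assoc intro: summable_mult)

lemma Lambda1_norm_scale:
  assumes "x \<in> Lambda1" "1 \<le> k"
  shows "Lambda1_norm k (seq_scale c x) = norm c * Lambda1_norm k x"
  using suminf_mult[OF Lambda1_summable[OF assms], of "norm c"]
  by (simp add: Lambda1_norm_weight seq_scale_def norm_mult mult.assoc)

lemma Lambda1_norm_mono:
  assumes "x \<in> Lambda1" "1 \<le> k" "k \<le> l"
  shows "Lambda1_norm k x \<le> Lambda1_norm l x"
proof -
  have "Lambda1_weight k i \<le> Lambda1_weight l i" for i
    using assms by (auto simp: Lambda1_weight_def intro!: divide_left_mono)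
  then show ?thesis
    unfolding Lambda1_norm_weight using assms
    by (intro suminf_le Lambda1_summable mult_left_mono) auto
qed

interpretation Lambda1: seminorm_family Lambda1 Lambda1_norm
proof
  show "Lambda1_norm p (x - y) = Lambda1_norm p (y - x)" for p and x y :: "nat \<Rightarrow> 'a"
    by (simp add: Lambda1_norm_def norm_minus_commute)
qed (auto simp: Lambda1_diff Lambda1_add_aux(2), simp add: Lambda1_norm_def)

text \<open>
  The countable triangle inequality. For finitely many coordinates the two sums may be
  interchanged; the resulting bound does not depend on their number, so it passes to the full norm.
\<close>

lemma Lambda1_norm_suminf_le:
  assumes mem: "\<And>n. u n \<in> Lambda1" and k: "1 \<le> k" and sum: "summable (\<lambda>n. Lambda1_norm k (u n))"
  shows "summable (\<lambda>n. u n j)"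
    and "summable (\<lambda>j. norm (\<Sum>n. u n j) * Lambda1_weight k j)"
    and "Lambda1_norm k (\<lambda>j. \<Sum>n. u n j) \<le> (\<Sum>n. Lambda1_norm k (u n))"
proof -
  let ?w = "Lambda1_weight k"
  have sw: "summable (\<lambda>n. norm (u n j) * ?w j)" for j
    by (rule summable_comparison_test'[OF sum, of 0])
       (use Lambda1_norm_coord_le[OF mem k] in \<open>simp add: Lambda1_weight_nonneg abs_mult\<close>)
  have sn: "summable (\<lambda>n. norm (u n j))" for j
    using sw[of j] summable_cmult_iff[of "?w j" "\<lambda>n. norm (u n j)"] Lambda1_weight_pos[of k j]
    by (simp add: mult.commute)
  show "summable (\<lambda>n. u n j)" by (rule summable_norm_cancel[OF sn])
  have partial: "(\<Sum>j<J. norm (\<Sum>n. u n j) * ?w j) \<le> (\<Sum>n. Lambda1_norm k (u n))" for J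
  proof -
    have "(\<Sum>j<J. norm (\<Sum>n. u n j) * ?w j) \<le> (\<Sum>j<J. (\<Sum>n. norm (u n j) * ?w j))"
      using summable_norm[OF sn] suminf_mult2[OF sn]
      by (intro sum_mono) (metis mult_right_mono Lambda1_weight_nonneg)
    also have "\<dots> = (\<Sum>n. \<Sum>j<J. norm (u n j) * ?w j)"
      by (rule suminf_sum[symmetric]) (rule sw)
    also have "\<dots> \<le> (\<Sum>n. Lambda1_norm k (u n))"
      using Lambda1_summable[OF mem k]
      by (intro suminf_le summable_sum sw sum)
         (auto simp: Lambda1_norm_weight Lambda1_weight_nonneg intro!: sum_le_suminf)
    finally show ?thesis .
  qed
  show s: "summable (\<lambda>j. norm (\<Sum>n. u n j) * ?w j)"
    by (rule summableI_nonneg_bounded[OF _ partial]) (simp add: Lambda1_weight_nonneg)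
  show "Lambda1_norm k (\<lambda>j. \<Sum>n. u n j) \<le> (\<Sum>n. Lambda1_norm k (u n))"
    unfolding Lambda1_norm_weight[of k "\<lambda>j. \<Sum>n. u n j"] by (rule suminf_le_const[OF s partial])
qed

section \<open>Operators determined by the images of the basis vectors\<close>

text \<open>
  The weight on the right is the norm of the \<open>n\<close>-th basis vector. So this is the bound of a
  strongly tame operator with constants \<open>K k\<close>, tested on the basis only.
\<close>

definition tame_columns :: "(nat \<Rightarrow> nat \<Rightarrow> 'a::{real_normed_field,banach}) \<Rightarrow> (nat \<Rightarrow> real) \<Rightarrow> bool" where
  "tame_columns B K \<longleftrightarrow>
     (\<forall>n. B n \<in> Lambda1) \<and> (\<forall>k\<ge>1. \<forall>n. Lambda1_norm k (B n) \<le> K k * Lambda1_weight k n)"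

text \<open>
  The offset \<open>N\<close> serves two purposes: \<open>N = 0\<close> gives the operator itself, and \<open>N \<rightarrow> \<infinity>\<close> gives the
  remainders of its series.
\<close>

lemma tame_columns_series:
  assumes B: "tame_columns B K" and x: "x \<in> Lambda1" and k: "1 \<le> k"
  shows "summable (\<lambda>n. x (n + N) * B (n + N) j)"
    and "summable (\<lambda>j. norm (\<Sum>n. x (n + N) * B (n + N) j) * Lambda1_weight k j)"
    and "Lambda1_norm k (\<lambda>j. \<Sum>n. x (n + N) * B (n + N) j)
           \<le> K k * (\<Sum>n. norm (x (n + N)) * Lambda1_weight k (n + N))"
proof -
  define u where "u n = seq_scale (x (n + N)) (B (n + N))" for n
  have mem: "u n \<in> Lambda1" for n
    using B by (simp add: u_def tame_columns_def Lambda1_scale)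
  have le: "Lambda1_norm k (u n) \<le> K k * (norm (x (n + N)) * Lambda1_weight k (n + N))" for n
    using B k mult_left_mono[of "Lambda1_norm k (B (n + N))" "K k * Lambda1_weight k (n + N)" "norm (x (n + N))"]
    by (simp add: u_def tame_columns_def Lambda1_norm_scale mult_ac)
  have sx: "summable (\<lambda>n. norm (x (n + N)) * Lambda1_weight k (n + N))"
    using Lambda1_summable[OF x k] summable_iff_shift[of "\<lambda>n. norm (x n) * Lambda1_weight k n" N] by blast
  have su: "summable (\<lambda>n. Lambda1_norm k (u n))"
    by (rule summable_comparison_test'[OF summable_mult[OF sx, of "K k"], of 0])
       (use le Lambda1_norm_nonneg[OF mem k] in simp)
  have eq: "u n j = x (n + N) * B (n + N) j" for n j by (simp add: u_def seq_scale_def)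
  note L = Lambda1_norm_suminf_le[OF mem k su, unfolded eq]
  show "summable (\<lambda>n. x (n + N) * B (n + N) j)" by (rule L(1))
  show "summable (\<lambda>j. norm (\<Sum>n. x (n + N) * B (n + N) j) * Lambda1_weight k j)" by (rule L(2))
  have "(\<Sum>n. Lambda1_norm k (u n)) \<le> (\<Sum>n. K k * (norm (x (n + N)) * Lambda1_weight k (n + N)))"
    by (intro suminf_le le su summable_mult sx)
  also have "\<dots> = K k * (\<Sum>n. norm (x (n + N)) * Lambda1_weight k (n + N))"
    by (rule suminf_mult[OF sx])
  finally show "Lambda1_norm k (\<lambda>j. \<Sum>n. x (n + N) * B (n + N) j)
           \<le> K k * (\<Sum>n. norm (x (n + N)) * Lambda1_weight k (n + N))"
    using L(3) by (simp add: u_def seq_scale_def)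
qed

lemma tame_columns_apply:
  assumes "tame_columns B K" "x \<in> Lambda1"
  shows "(\<lambda>j. \<Sum>n. x n * B n j) \<in> Lambda1"
    and "1 \<le> k \<Longrightarrow> Lambda1_norm k (\<lambda>j. \<Sum>n. x n * B n j) \<le> K k * Lambda1_norm k x"
  using tame_columns_series(2)[OF assms, of _ 0] tame_columns_series(3)[OF assms, of _ 0]
  by (auto simp: Lambda1_iff Lambda1_norm_weight)

lemma tame_columns_limit:
  assumes B: "tame_columns B K" and x: "x \<in> Lambda1"
  shows "limitin (seminorm_topology Lambda1 Lambda1_norm)
           (\<lambda>N. \<Sum>n<N. seq_scale (x n) (B n)) (\<lambda>j. \<Sum>n. x n * B n j) sequentially"
  unfolding Lambda1.limitin_seminorm_topology
proof (intro conjI allI impI)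
  define y where "y = (\<lambda>j. \<Sum>n. x n * B n j)"
  define S where "S N = (\<Sum>n<N. seq_scale (x n) (B n))" for N
  have S_mem: "S N \<in> Lambda1" for N
  proof (induction N)
    case 0
    show ?case by (simp add: S_def Lambda1_iff)
  next
    case (Suc N)
    have "seq_scale (x N) (B N) \<in> Lambda1"
      using B by (simp add: tame_columns_def Lambda1_scale)
    then show ?case
      using Lambda1_add[OF Suc] unfolding S_def sum.lessThan_Suc by blast
  qed
  have S_apply: "S N j = (\<Sum>n<N. x n * B n j)" for N j
    by (induction N) (simp_all add: S_def seq_scale_def)
  show "(\<lambda>j. \<Sum>n. x n * B n j) \<in> Lambda1" by (rule tame_columns_apply[OF B x])
  fix k :: nat and \<epsilon> :: real assume k: "1 \<le> k" and \<epsilon>: "0 < \<epsilon>"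
  have diff: "y - S N = (\<lambda>j. \<Sum>n. x (n + N) * B (n + N) j)" for N
  proof
    fix j
    show "(y - S N) j = (\<Sum>n. x (n + N) * B (n + N) j)"
      using suminf_minus_initial_segment[OF tame_columns_series(1)[OF B x k, of 0 j, simplified], of N]
      by (simp add: y_def S_apply)
  qed
  let ?g = "\<lambda>N. K k * (\<Sum>n. norm (x (n + N)) * Lambda1_weight k (n + N))"
  have "?g \<longlonglongrightarrow> K k * 0"
    by (intro tendsto_mult_left suminf_exist_split2 Lambda1_summable x k)
  then have "\<forall>\<^sub>F N in sequentially. ?g N < \<epsilon>"
    using \<epsilon> by (intro order_tendstoD(2)) auto
  then show "\<forall>\<^sub>F N in sequentially. (\<Sum>n<N. seq_scale (x n) (B n))
      \<in> Lambda1.seminorm_ball k (\<lambda>j. \<Sum>n. x n * B n j) \<epsilon>"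
  proof (rule eventually_mono)
    fix N assume "?g N < \<epsilon>"
    then have "Lambda1_norm k (y - S N) < \<epsilon>"
      using tame_columns_series(3)[OF B x k, of N] by (simp add: diff)
    then have "S N \<in> Lambda1.seminorm_ball k y \<epsilon>"
      using S_mem[of N] by (simp add: Lambda1_norm_def norm_minus_commute)
    then show "(\<Sum>n<N. seq_scale (x n) (B n))
      \<in> Lambda1.seminorm_ball k (\<lambda>j. \<Sum>n. x n * B n j) \<epsilon>" by (simp add: S_def y_def)
  qed
qed

text \<open>
  A single seminorm already separates points, since all weights are positive.
\<close>

lemma Lambda1_limit_unique:
  assumes "limitin (seminorm_topology Lambda1 Lambda1_norm) f y F"
    and "limitin (seminorm_topology Lambda1 Lambda1_norm) f z F" and "F \<noteq> bot"
  shows "y = z"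
proof
  fix i
  have mem: "y - z \<in> Lambda1"
    using assms Lambda1_diff unfolding Lambda1.limitin_seminorm_topology by blast
  have "norm ((y - z) i) * Lambda1_weight 1 i \<le> 0"
    using Lambda1_norm_coord_le[OF mem, of 1 i] Lambda1.limitin_seminorm_unique[OF assms, of 1] by simp
  then show "y i = z i"
    using Lambda1_weight_pos[of 1 i] by (simp add: mult_le_0_iff)
qed

lemma basis_extension_eq:
  assumes "tame_columns B K" "x \<in> Lambda1"
  shows "basis_extension B x = (\<lambda>j. \<Sum>n. x n * B n j)"
  unfolding basis_extension_def
  using tame_columns_limit[OF assms] Lambda1_limit_unique sequentially_bot by (metis (lifting) the_equality)

lemma basis_extension_linear:
  assumes B: "tame_columns B K"
  shows "linear_operator seq_scale Lambda1 (basis_extension B)"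
  unfolding linear_operator_def
proof (intro conjI ballI allI)
  note s = tame_columns_series(1)[OF B _ order_refl, of _ 0, simplified]
  show "basis_extension B ` Lambda1 \<subseteq> Lambda1"
    using tame_columns_apply(1)[OF B] by (auto simp: basis_extension_eq[OF B])
  fix x :: "nat \<Rightarrow> 'a" assume x: "x \<in> Lambda1"
  show "basis_extension B (x + y) = basis_extension B x + basis_extension B y" if y: "y \<in> Lambda1" for y
    using suminf_add[OF s[OF x] s[OF y]]
    by (simp add: basis_extension_eq[OF B] x y Lambda1_add fun_eq_iff distrib_right)
  show "basis_extension B (seq_scale c x) = seq_scale c (basis_extension B x)" for c
    using suminf_mult[OF s[OF x], of c]
    by (simp add: basis_extension_eq[OF B] x Lambda1_scale fun_eq_iff) (simp add: seq_scale_def mult.assoc)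
qed

lemma basis_extension_norm_le:
  assumes "tame_columns B K" "x \<in> Lambda1" "1 \<le> k"
  shows "Lambda1_norm k (basis_extension B x) \<le> K k * Lambda1_norm k x"
  using tame_columns_apply(2)[OF assms] by (simp add: basis_extension_eq[OF assms(1,2)])

section \<open>The two triangular parts of a Toeplitz operator\<close>

text \<open>
  The \<open>n\<close>-th column is \<open>\<theta>\<close> shifted by \<open>n\<close>. The factor \<open>exp (1 / k)\<close> appears because the weights start
  with the exponent \<open>1\<close> rather than \<open>0\<close>: the product of the weights at \<open>i\<close> and \<open>n\<close> counts this unit
  twice, the weight at \<open>i + n\<close> only once.
\<close>

lemma tame_columns_hat:
  assumes \<theta>: "\<theta> \<in> Lambda1"
  shows "tame_columns (\<lambda>n j. if n \<le> j then \<theta> (j - n) else 0) (\<lambda>k. exp (1 / real k) * Lambda1_norm k \<theta>)"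
proof -
  have *: "(\<lambda>j. norm (if n \<le> j then \<theta> (j - n) else 0) * Lambda1_weight k j)
      sums (exp (1 / real k) * Lambda1_norm k \<theta> * Lambda1_weight k n)" if k: "1 \<le> k" for n k
  proof -
    have shift: "Lambda1_weight k (i + n) = exp (1 / real k) * Lambda1_weight k n * Lambda1_weight k i" for i
      using k by (simp add: Lambda1_weight_def exp_add[symmetric] field_simps)
    have "(\<lambda>i. (exp (1 / real k) * Lambda1_weight k n) * (norm (\<theta> i) * Lambda1_weight k i))
        sums ((exp (1 / real k) * Lambda1_weight k n) * Lambda1_norm k \<theta>)"
      unfolding Lambda1_norm_weight by (intro sums_mult summable_sums Lambda1_summable \<theta> k)
    then have "(\<lambda>i. norm (if n \<le> i + n then \<theta> (i + n - n) else 0) * Lambda1_weight k (i + n))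
        sums (exp (1 / real k) * Lambda1_norm k \<theta> * Lambda1_weight k n)"
      by (simp add: shift mult_ac)
    then show ?thesis by (subst (asm) sums_iff_shift) simp
  qed
  show ?thesis
    unfolding tame_columns_def Lambda1_iff Lambda1_norm_weight[of _ "\<lambda>j. if _ \<le> j then _ j else 0"]
    using * by (auto simp: sums_iff)
qed

text \<open>
  The entry \<open>\<beta> i\<close> stands \<open>i\<close> places above the diagonal, where the weight exceeds the one at \<open>n\<close> by the
  factor \<open>exp (i / k)\<close>. Bounding it by \<open>exp (i + 1)\<close> gives one constant for all \<open>k\<close>.
\<close>

lemma tame_columns_check:
  assumes \<beta>: "summable (\<lambda>n. norm (\<beta> n) * exp (real (n + 1)))"
  shows "tame_columns (\<lambda>n j. if j \<le> n then \<beta> (n - j) else 0)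
           (\<lambda>k. \<Sum>n. norm (\<beta> n) * exp (real (n + 1)))"
proof -
  let ?b = "\<Sum>n. norm (\<beta> n) * exp (real (n + 1))"
  have sums: "(\<lambda>j. norm (if j \<le> n then \<beta> (n - j) else 0) * Lambda1_weight k j)
      sums (\<Sum>j\<le>n. norm (\<beta> (n - j)) * Lambda1_weight k j)" for n k
    using sums_If_finite_set[of "{..n}" "\<lambda>j. norm (\<beta> (n - j)) * Lambda1_weight k j"]
    by (simp add: if_distrib[of norm] if_distrib[of "\<lambda>t. t * _"] cong: if_cong)
  have "(\<Sum>j\<le>n. norm (\<beta> (n - j)) * Lambda1_weight k j) \<le> ?b * Lambda1_weight k n" if k: "1 \<le> k" for n k
  proof -
    have "(\<Sum>j\<le>n. norm (\<beta> (n - j)) * Lambda1_weight k j)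
        = (\<Sum>i\<le>n. norm (\<beta> i) * Lambda1_weight k (n - i))"
      by (rule sum.reindex_bij_witness[of _ "\<lambda>i. n - i" "\<lambda>i. n - i"]) auto
    also have "\<dots> \<le> (\<Sum>i\<le>n. norm (\<beta> i) * exp (real (i + 1)) * Lambda1_weight k n)"
    proof (rule sum_mono)
      fix i assume i: "i \<in> {..n}"
      have "real i / real k \<le> real i" using k mult_left_mono[of 1 "real k" "real i"] by (simp add: divide_le_eq)
      then have "- (real (n - i + 1) / real k) \<le> real (i + 1) - real (n + 1) / real k"
        using i by (simp add: of_nat_diff add_divide_distrib diff_divide_distrib)
      then have "Lambda1_weight k (n - i) \<le> exp (real (i + 1)) * Lambda1_weight k n"
        by (simp add: Lambda1_weight_def exp_add[symmetric])
      then show "norm (\<beta> i) * Lambda1_weight k (n - i) \<le> norm (\<beta> i) * exp (real (i + 1)) * Lambda1_weight k n"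
        by (simp add: mult.assoc mult_left_mono)
    qed
    also have "\<dots> \<le> ?b * Lambda1_weight k n"
      unfolding sum_distrib_right[symmetric]
      by (intro mult_right_mono sum_le_suminf \<beta>) (auto simp: Lambda1_weight_nonneg)
    finally show ?thesis .
  qed
  then show ?thesis
    unfolding tame_columns_def Lambda1_iff Lambda1_norm_weight[of _ "\<lambda>j. if j \<le> _ then _ j else 0"]
    using sums by (auto simp: sums_iff)
qed

lemma toeplitz_linear:
  assumes "\<theta> \<in> Lambda1" "summable (\<lambda>n. norm (\<beta> n) * exp (real (n + 1)))"
  shows "linear_operator seq_scale Lambda1 (toeplitz \<theta> \<beta>)"
  using basis_extension_linear[OF tame_columns_hat[OF assms(1)]]
    basis_extension_linear[OF tame_columns_check[OF assms(2)]]
  unfolding linear_operator_def toeplitz_def toeplitz_hat_def toeplitz_check_def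
  by (auto simp: Lambda1_add image_subset_iff add_ac)
     (simp add: seq_scale_def distrib_left fun_eq_iff)

lemma toeplitz_norm_le:
  assumes \<theta>: "\<theta> \<in> Lambda1" and \<beta>: "summable (\<lambda>n. norm (\<beta> n) * exp (real (n + 1)))"
    and x: "x \<in> Lambda1" and k: "1 \<le> k"
  shows "Lambda1_norm k (toeplitz \<theta> \<beta> x)
    \<le> (exp (1 / real k) * Lambda1_norm k \<theta> + (\<Sum>n. norm (\<beta> n) * exp (real (n + 1)))) * Lambda1_norm k x"
proof -
  note H = tame_columns_hat[OF \<theta>] and C = tame_columns_check[OF \<beta>]
  have "toeplitz_hat \<theta> x \<in> Lambda1" "toeplitz_check \<beta> x \<in> Lambda1"
    using basis_extension_linear[OF H] basis_extension_linear[OF C] x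
    unfolding toeplitz_hat_def toeplitz_check_def linear_operator_def by auto
  then have "Lambda1_norm k (toeplitz \<theta> \<beta> x)
      \<le> Lambda1_norm k (toeplitz_hat \<theta> x) + Lambda1_norm k (toeplitz_check \<beta> x)"
    unfolding toeplitz_def using k by (rule Lambda1_add_aux(2))
  then show ?thesis
    using basis_extension_norm_le[OF H x k] basis_extension_norm_le[OF C x k]
    unfolding toeplitz_hat_def toeplitz_check_def by (simp add: distrib_right)
qed

lemma toeplitz_strongly_tame:
  assumes \<theta>: "\<theta> \<in> Lambda1" and \<beta>: "summable (\<lambda>n. norm (\<beta> n) * exp (real (n + 1)))"
  shows "strongly_tame seq_scale Lambda1 Lambda1_norm (toeplitz \<theta> \<beta>)"
  unfolding strongly_tame_def
proof (intro conjI allI impI)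
  show "linear_operator seq_scale Lambda1 (toeplitz \<theta> \<beta>)" by (rule toeplitz_linear[OF assms])
  fix p :: nat assume p: "1 \<le> p"
  \<comment> \<open>One is added because the constant has to be positive, and \<open>?C\<close> vanishes for zero symbols.\<close>
  let ?C = "exp (1 / real p) * Lambda1_norm p \<theta> + (\<Sum>n. norm (\<beta> n) * exp (real (n + 1)))"
  have "Lambda1_norm p (toeplitz \<theta> \<beta> x) \<le> (?C + 1) * Lambda1_norm p x" if x: "x \<in> Lambda1" for x
    using toeplitz_norm_le[OF assms x p] Lambda1_norm_nonneg[OF x p] by (simp add: distrib_right)
  moreover have "0 \<le> ?C"
    using Lambda1_norm_nonneg[OF \<theta> p] suminf_nonneg[OF \<beta>] by simp
  ultimately show "\<exists>C>0. \<forall>x\<in>Lambda1. Lambda1_norm p (toeplitz \<theta> \<beta> x) \<le> C * Lambda1_norm p x"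
    by (intro exI[of _ "?C + 1"]) auto
qed

text \<open>
  The assumption makes the operator a contraction for the seminorms of even index. These are
  cofinal, and one of them dominates each of the others.
\<close>

lemma toeplitz_power_bounded:
  assumes \<theta>: "\<theta> \<in> Lambda1" and \<beta>: "summable (\<lambda>n. norm (\<beta> n) * exp (real (n + 1)))"
    and le: "\<And>p. 1 \<le> p \<Longrightarrow> exp (1 / (2 * real p)) * Lambda1_norm (2 * p) \<theta>
               + (\<Sum>n. norm (\<beta> n) * exp (real (n + 1))) \<le> 1"
  shows "power_bounded seq_scale Lambda1 Lambda1_norm (toeplitz \<theta> \<beta>)"
  unfolding power_bounded_def
proof (intro conjI allI impI)
  let ?T = "toeplitz \<theta> \<beta>"
  show "continuous_linear_operator seq_scale Lambda1 Lambda1_norm ?T"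
    by (rule Lambda1.continuous_if_strongly_tame[OF toeplitz_strongly_tame[OF \<theta> \<beta>]])
  fix p :: nat assume p: "1 \<le> p"
  have T: "?T ` Lambda1 \<subseteq> Lambda1"
    using toeplitz_linear[OF \<theta> \<beta>] unfolding linear_operator_def by blast
  have contr: "Lambda1_norm (2 * p) (?T x) \<le> 1 * Lambda1_norm (2 * p) x" if x: "x \<in> Lambda1" for x
    using toeplitz_norm_le[OF \<theta> \<beta> x, of "2 * p"] mult_right_mono[OF le[OF p] Lambda1_norm_nonneg[OF x, of "2 * p"]] p
    by simp
  have "Lambda1_norm p ((?T ^^ k) x) \<le> 1 * Lambda1_norm (2 * p) x" if x: "x \<in> Lambda1" for k x
  proof -
    have "(?T ^^ k) x \<in> Lambda1 \<and> Lambda1_norm (2 * p) ((?T ^^ k) x) \<le> 1 ^ k * Lambda1_norm (2 * p) x"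
      using funpow_seminorm_bound[where Q = "Lambda1_norm (2 * p)" and C = 1, OF T contr _ x] by simp
    then show ?thesis using Lambda1_norm_mono[of "(?T ^^ k) x" p "2 * p"] p by simp
  qed
  then show "\<exists>q\<ge>1. \<exists>C\<ge>1. \<forall>k\<ge>1. \<forall>x\<in>Lambda1. Lambda1_norm p ((?T ^^ k) x) \<le> C * Lambda1_norm q x"
    using p by (intro exI[of _ "2 * p"] conjI exI[of _ 1]) auto
qed

theorem proposition6p6:
  fixes \<theta> \<beta> :: "nat \<Rightarrow> 'a::{real_normed_field,banach}"
  assumes "\<theta> \<in> Lambda1" and "\<beta> \<in> Lambda1_dual"
  shows "((\<Sum>n. ennreal (norm (\<beta> n) * exp (real (n + 1)))) < \<infinity> \<longrightarrow>
            strongly_tame seq_scale Lambda1 Lambda1_norm (toeplitz \<theta> \<beta>) \<and>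
            m_topologizable seq_scale Lambda1 Lambda1_norm (toeplitz \<theta> \<beta>)) \<and>
         ((SUP p\<in>{1..}. ennreal (exp (1 / (2 * real p)) * Lambda1_norm (2 * p) \<theta>))
            + (\<Sum>n. ennreal (norm (\<beta> n) * exp (real (n + 1)))) \<le> 1 \<longrightarrow>
            power_bounded seq_scale Lambda1 Lambda1_norm (toeplitz \<theta> \<beta>))"
proof (intro conjI impI)
  let ?f = "\<lambda>n. norm (\<beta> n) * exp (real (n + 1))"
  have summable: "summable ?f" if "(\<Sum>n. ennreal (?f n)) < \<infinity>"
    using that by (intro summable_suminf_not_top) auto
  show tame: "strongly_tame seq_scale Lambda1 Lambda1_norm (toeplitz \<theta> \<beta>)"
    if "(\<Sum>n. ennreal (?f n)) < \<infinity>"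
    by (rule toeplitz_strongly_tame[OF assms(1) summable[OF that]])
  show "m_topologizable seq_scale Lambda1 Lambda1_norm (toeplitz \<theta> \<beta>)"
    if "(\<Sum>n. ennreal (?f n)) < \<infinity>"
    by (rule Lambda1.m_topologizable_if_strongly_tame[OF tame[OF that] Lambda1_norm_nonneg])
  let ?g = "\<lambda>p. exp (1 / (2 * real p)) * Lambda1_norm (2 * p) \<theta>"
  assume le: "(SUP p\<in>{1..}. ennreal (?g p)) + (\<Sum>n. ennreal (?f n)) \<le> 1"
  then have "(\<Sum>n. ennreal (?f n)) \<le> 1"
    by (rule order_trans[rotated]) (simp add: add_increasing)
  then have f: "summable ?f"
    by (intro summable) (metis ennreal_one_less_top infinity_ennreal_def le_less_trans)
  show "power_bounded seq_scale Lambda1 Lambda1_norm (toeplitz \<theta> \<beta>)"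
  proof (rule toeplitz_power_bounded[OF assms(1) f])
    fix p :: nat assume p: "1 \<le> p"
    have nonneg: "0 \<le> ?g p" "0 \<le> (\<Sum>n. ?f n)"
      using Lambda1_norm_nonneg[OF assms(1), of "2 * p"] p suminf_nonneg[OF f] by auto
    have "ennreal (?g p + (\<Sum>n. ?f n)) = ennreal (?g p) + (\<Sum>n. ennreal (?f n))"
      using nonneg by (subst suminf_ennreal2[OF _ f]) (simp_all only: ennreal_plus, simp)
    also have "\<dots> \<le> (SUP p\<in>{1..}. ennreal (?g p)) + (\<Sum>n. ennreal (?f n))"
      using p by (intro add_right_mono SUP_upper) auto
    also have "\<dots> \<le> ennreal 1" using le by simp
    finally show "?g p + (\<Sum>n. ?f n) \<le> 1"
      by (subst (asm) ennreal_le_iff) auto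
  qed
qed

end
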